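(* Let $P=V_0V_1\dots V_{n-1}$ be a polygon in the plane, and let $V_0X_1X_2\dots X_mV_k$ be a polygonal line from the vertex $V_0$ to the vertex $V_k$ of $P$. Let $$ Q=V_0V_1\dots V_kX_mX_{m-1}\dots X_1,\qquad R=V_0X_1X_2\dots X_mV_kV_{k+1}\dots V_{n-1} $$ be the two closed polygons resulting from cutting $P$ along this polygonal line. Assume that the signed areas $A(P)$, $A(Q)$, $A(R)$ are nonzero. Then $$ CCM(P)=\frac{A(Q)\,CCM(Q)+A(R)\,CCM(R)}{A(Q)+A(R)} . $$
   Context: A polygon $P=(V_0,\dots,V_{n-1})$, $n\ge 3$, is a closed oriented polygon in $\mathbb{R}^2$ given by the cyclic sequence of its vertices (indices mod $n$), consecutive vertices being distinct; self-intersections are allowed. With $V_i=(x_i,y_i)$ its signed area is $A(P)=\tfrac12\sum_i (x_iy_{i+1}-x_{i+1}y_i)$. If $A(P)\ne0$, the Circumcenter of Mass is $$CCM(P)=\sum_i \frac{A_i}{A(P)}\,C_i,$$ where $O$ is any point not on the sides of $P$ or their extensions, $C_i$ is the circumcenter of the triangle $OV_iV_{i+1}$, and $A_i=\tfrac12\det(V_i-O,V_{i+1}-O)$ is its signed area; this does not depend on the choice of $O$. *)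

theory Defs
  imports "HOL-Analysis.Analysis"
begin

text \<open>A closed polygon is given by the list of its vertices \<open>V\<^sub>0, \<dots>, V\<^sub>n\<^sub>-\<^sub>1\<close>, read cyclically.\<close>

type_synonym point = "real^2"

definition vertex :: "point list \<Rightarrow> nat \<Rightarrow> point" where
  "vertex P i = P ! (i mod length P)"

definition polygon :: "point list \<Rightarrow> bool" where
  "polygon P \<longleftrightarrow> length P \<ge> 3 \<and> (\<forall>i<length P. vertex P i \<noteq> vertex P (i + 1))"

definition polygonal_line :: "point list \<Rightarrow> bool" where
  "polygonal_line L \<longleftrightarrow> length L \<ge> 2 \<and> successively (\<noteq>) L"

definition signed_area :: "point list \<Rightarrow> real" where
  "signed_area P = (1/2) * (\<Sum>i<length P.
     vertex P i $ 1 * vertex P (i + 1) $ 2 - vertex P (i + 1) $ 1 * vertex P i $ 2)"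

definition triangle_area :: "point \<Rightarrow> point \<Rightarrow> point \<Rightarrow> real" where
  "triangle_area a b c = (1/2) * det (vector [b - a, c - a] :: real^2^2)"

text \<open>Meaningful only for non-collinear \<open>a\<close>, \<open>b\<close>, \<open>c\<close>; otherwise the point need not exist or be unique.\<close>

definition circumcenter :: "point \<Rightarrow> point \<Rightarrow> point \<Rightarrow> point" where
  "circumcenter a b c = (THE p. dist p a = dist p b \<and> dist p b = dist p c)"

text \<open>The affine hull of two consecutive vertices is the side together with its extensions.\<close>

definition admissible_base :: "point list \<Rightarrow> point \<Rightarrow> bool" where
  "admissible_base P B \<longleftrightarrow> (\<forall>i<length P. B \<notin> affine hull {vertex P i, vertex P (i + 1)})"

definition CCM_wrt :: "point \<Rightarrow> point list \<Rightarrow> point" where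
  "CCM_wrt B P = (\<Sum>i<length P.
     (triangle_area B (vertex P i) (vertex P (i + 1)) / signed_area P) *\<^sub>R
       circumcenter B (vertex P i) (vertex P (i + 1)))"

text \<open>
  The circumcenter of mass of a polygon of nonzero signed area. The value does not depend on
  the choice of the admissible base point; for signed area zero it is a junk value.
\<close>

definition CCM :: "point list \<Rightarrow> point" where
  "CCM P = CCM_wrt (SOME B. admissible_base P B) P"

end

theory Submission
  imports Defs
begin

text \<open>
  The area-weighted circumcenter of \<open>B u v\<close> is a function of \<open>u\<close> and \<open>v\<close> that does not depend on
  \<open>B\<close> and is antisymmetric in \<open>u\<close> and \<open>v\<close>, plus a difference \<open>h v - h u\<close> which cancels around a closed polygon.
  Hence \<open>A(P) CCM(P)\<close>, like \<open>A(P)\<close> itself, is a cyclic sum of an antisymmetric function over the edges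
  of \<open>P\<close>. Such sums add up under cutting, since the cut is traversed once in each direction.
\<close>

section \<open>Edge sums along open and closed paths\<close>

fun path_sum :: "('a \<Rightarrow> 'a \<Rightarrow> 'b::ab_group_add) \<Rightarrow> 'a list \<Rightarrow> 'b" where
  "path_sum f (x # y # zs) = f x y + path_sum f (y # zs)"
| "path_sum f _ = 0"

text \<open>Follows the modular indexing of \<open>signed_area\<close> and \<open>CCM_wrt\<close>;
  splitting and reversing are done on \<open>path_sum\<close>, where list induction applies.\<close>

definition cyclic_sum :: "(point \<Rightarrow> point \<Rightarrow> 'b::ab_group_add) \<Rightarrow> point list \<Rightarrow> 'b" where
  "cyclic_sum f P = (\<Sum>i<length P. f (vertex P i) (vertex P (i + 1)))"

lemma path_sum_append:
  "path_sum f (xs @ x # ys) = path_sum f (xs @ [x]) + path_sum f (x # ys)"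
proof (induction xs)
  case (Cons a xs)
  then show ?case by (cases xs) (auto simp: add.assoc)
qed auto

lemma path_sum_rev:
  assumes "\<And>u v. f v u = - f u v"
  shows "path_sum f (rev xs) = - path_sum f xs"
proof (induction xs)
  case (Cons a xs)
  then show ?case
    using assms[of a] by (cases xs) (auto simp: path_sum_append[of f _ _ "[a]"])
qed auto

lemma path_sum_diff:
  "path_sum (\<lambda>u v. h v - h u) (x # xs) = h (last (x # xs)) - h x"
  by (induction xs arbitrary: x) auto

lemma path_sum_conv_sum:
  "path_sum f xs = (\<Sum>i<length xs - 1. f (xs ! i) (xs ! Suc i))"
proof (induction f xs rule: path_sum.induct)
  case (1 f x y zs)
  then show ?case by (simp add: sum.lessThan_Suc_shift del: sum.lessThan_Suc)
qed auto

lemma cyclic_sum_Cons: "cyclic_sum f (x # xs) = path_sum f (x # xs @ [x])"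
  unfolding cyclic_sum_def path_sum_conv_sum
proof (rule sum.cong)
  fix i assume "i \<in> {..<length ((x # xs @ [x])) - 1}"
  then have "i \<le> length xs" by simp
  then have "vertex (x # xs) i = (x # xs @ [x]) ! i"
    by (cases i) (auto simp: vertex_def nth_append)
  moreover have "vertex (x # xs) (i + 1) = (x # xs @ [x]) ! Suc i"
    using \<open>i \<le> length xs\<close> by (cases "i = length xs") (auto simp: vertex_def nth_append)
  ultimately show "f (vertex (x # xs) i) (vertex (x # xs) (i + 1))
      = f ((x # xs @ [x]) ! i) ((x # xs @ [x]) ! Suc i)" by simp
qed simp

lemma cyclic_sum_diff: "cyclic_sum (\<lambda>u v. h v - h u) P = 0"
proof (cases P)
  case Nil
  then show ?thesis by (simp add: cyclic_sum_def)
next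
  case (Cons x xs)
  show ?thesis unfolding Cons cyclic_sum_Cons path_sum_diff by simp
qed

text \<open>All three polygons start at the vertex 0, so each closes up to a path returning there. Q
  follows the first half of P and then the cut backwards, R follows the cut forwards and then the
  second half. By antisymmetry the two passes along the cut cancel.\<close>

lemma cyclic_sum_cut:
  assumes anti: "\<And>u v. f v u = - f u v" and "k < length P"
  shows "cyclic_sum f P = cyclic_sum f (map (vertex P) [0..<k+1] @ rev X)
           + cyclic_sum f (vertex P 0 # X @ map (vertex P) [k..<length P])"
proof -
  define n where "n = length P"
  define a where "a = vertex P 0"
  define v where "v = vertex P k"
  \<comment> \<open>The part of closed P after \<open>v\<close>; for k = n - 1 it is just the
    closing vertex \<open>a\<close>.\<close>
  define bs where "bs = map (vertex P) [Suc k..<n] @ [a]"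
  have "k < n" using assms by (simp add: n_def)
  have P: "P = map (vertex P) [0..<n]"
    by (rule nth_equalityI) (auto simp: vertex_def n_def)
  have closed: "cyclic_sum f L = path_sum f (L @ [a])" if "L \<noteq> []" "hd L = a" for L
    using that cyclic_sum_Cons[of f a "tl L"] by (cases L) auto
  have head: "hd (map (vertex P) [0..<Suc m]) = a" for m
    by (simp add: a_def upt_conv_Cons del: upt_Suc)
  have "[0..<n] = [0..<k] @ k # [Suc k..<n]"
    using \<open>k < n\<close> by (metis less_imp_add_positive upt_add_eq_append upt_conv_Cons zero_le)
  then have Pa: "P @ [a] = map (vertex P) [0..<k] @ v # bs"
    by (subst P) (simp add: v_def bs_def)
  have hdP: "hd P = a" "P \<noteq> []"
    using \<open>k < n\<close> by (cases P; simp add: a_def vertex_def n_def)+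
  let ?Q = "map (vertex P) [0..<k+1] @ rev X" and ?R = "a # X @ map (vertex P) [k..<n]"
  have "hd ?Q = a" using head[of k] by (simp add: hd_append del: upt_Suc)
  \<comment> \<open>The closing \<open>a\<close> becomes the endpoint of the reversed cut, as
    \<open>rev (a # X)\<close> is \<open>rev X @ [a]\<close>.\<close>
  then have "cyclic_sum f ?Q = path_sum f (map (vertex P) [0..<k] @ v # rev (a # X))"
    by (subst closed) (auto simp: v_def)
  also have "\<dots> = path_sum f (map (vertex P) [0..<k] @ [v]) + path_sum f (rev (a # X @ [v]))"
    by (subst path_sum_append) simp
  also have "path_sum f (rev (a # X @ [v])) = - path_sum f (a # X @ [v])"
    by (rule path_sum_rev[OF anti])
  finally have Q: "cyclic_sum f ?Q
    = path_sum f (map (vertex P) [0..<k] @ [v]) - path_sum f (a # X @ [v])" by simp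
  have "cyclic_sum f ?R = path_sum f ((a # X) @ v # bs)"
    using \<open>k < n\<close> by (subst closed) (auto simp: v_def bs_def upt_conv_Cons)
  also have "\<dots> = path_sum f (a # X @ [v]) + path_sum f (v # bs)"
    by (subst path_sum_append) simp
  finally have "cyclic_sum f ?Q + cyclic_sum f ?R
    = path_sum f (map (vertex P) [0..<k] @ [v]) + path_sum f (v # bs)" using Q by simp
  also have "\<dots> = cyclic_sum f P"
    using closed[OF hdP(2,1)] Pa path_sum_append[of f _ v bs] by metis
  finally show ?thesis by (simp add: a_def n_def)
qed

section \<open>Area-weighted circumcenters in coordinates\<close>

lemma triangle_area_expand:
  "triangle_area a b c = ((b$1 - a$1) * (c$2 - a$2) - (c$1 - a$1) * (b$2 - a$2)) / 2"
  by (simp add: triangle_area_def det_2 algebra_simps)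

text \<open>The circumcenter times the signed area, with the denominator cleared: a polynomial,
  hence meaningful for degenerate triangles too.\<close>

definition weighted_center :: "point \<Rightarrow> point \<Rightarrow> point \<Rightarrow> point" where
  "weighted_center a b c = (1/4) *\<^sub>R vector
     [(norm a)\<^sup>2 * (b$2 - c$2) + (norm b)\<^sup>2 * (c$2 - a$2) + (norm c)\<^sup>2 * (a$2 - b$2),
      (norm a)\<^sup>2 * (c$1 - b$1) + (norm b)\<^sup>2 * (a$1 - c$1) + (norm c)\<^sup>2 * (b$1 - a$1)]"

lemma norm_point_squared: "(norm (p::point))\<^sup>2 = (p$1)\<^sup>2 + (p$2)\<^sup>2"
  by (simp only: power2_norm_eq_inner) (simp add: inner_vec_def sum_2 power2_eq_square)

text \<open>The squared norm of p cancels, leaving the linear equation of the perpendicular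
  bisector.\<close>

lemma dist_eq_iff_bisector:
  fixes p a b :: point
  shows "dist p a = dist p b \<longleftrightarrow>
    2 * ((b$1 - a$1) * p$1 + (b$2 - a$2) * p$2) = (norm b)\<^sup>2 - (norm a)\<^sup>2"
proof -
  have "dist p a = dist p b \<longleftrightarrow> (norm (p - a))\<^sup>2 = (norm (p - b))\<^sup>2"
    by (simp add: dist_norm)
  then show ?thesis
    unfolding norm_point_squared by (simp add: power2_eq_square algebra_simps)
qed

text \<open>Two bisector equations form a linear system for p, solved by Cramer's rule; its
  determinant is a nonzero multiple of the area.\<close>

lemma equidistant_iff:
  assumes "triangle_area a b c \<noteq> 0"
  shows "dist p a = dist p b \<and> dist p b = dist p c \<longleftrightarrow>
    p = weighted_center a b c /\<^sub>R triangle_area a b c"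
proof -
  define s where "s = (norm b)\<^sup>2 - (norm a)\<^sup>2"
  define t where "t = (norm c)\<^sup>2 - (norm a)\<^sup>2"
  define d where "d = triangle_area a b c"
  have d: "d \<noteq> 0" and
    d_eq: "2 * d = (b$1 - a$1) * (c$2 - a$2) - (c$1 - a$1) * (b$2 - a$2)"
    using assms by (simp_all add: d_def triangle_area_expand)
  \<comment> \<open>These are the Cramer numerators for the right-hand sides \<open>s\<close> and
    \<open>t\<close>.\<close>
  have W: "4 * weighted_center a b c $ 1 = s * (c$2 - a$2) - t * (b$2 - a$2)"
     "4 * weighted_center a b c $ 2 = t * (b$1 - a$1) - s * (c$1 - a$1)"
    by (simp_all add: weighted_center_def s_def t_def algebra_simps)
  have "dist p a = dist p b \<and> dist p b = dist p c \<longleftrightarrow> dist p a = dist p b \<and> dist p a = dist p c"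
    by auto
  also have "\<dots> \<longleftrightarrow> 2 * ((b$1 - a$1) * p$1 + (b$2 - a$2) * p$2) = s \<and>
      2 * ((c$1 - a$1) * p$1 + (c$2 - a$2) * p$2) = t"
    by (simp only: dist_eq_iff_bisector s_def t_def)
  also have "\<dots> \<longleftrightarrow> d * p$1 = weighted_center a b c $ 1 \<and> d * p$2 = weighted_center a b c $ 2"
    (is "?L \<longleftrightarrow> ?R")
  proof
    assume L: ?L
    show ?R using W d_eq L by algebra
  next
    assume R: ?R
    \<comment> \<open>Scaling each equation by \<open>2 * d\<close> makes it a polynomial
      consequence of \<open>?R\<close>; the factor is cancelled afterwards.\<close>
    have "2 * d * (2 * ((b$1 - a$1) * p$1 + (b$2 - a$2) * p$2) - s) = 0"
      using W d_eq R by algebra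
    moreover have "2 * d * (2 * ((c$1 - a$1) * p$1 + (c$2 - a$2) * p$2) - t) = 0"
      using W d_eq R by algebra
    ultimately show ?L using d by simp
  qed
  also have "\<dots> \<longleftrightarrow> p = weighted_center a b c /\<^sub>R d"
    using d by (auto simp: vec_eq_iff forall_2 field_simps)
  finally show ?thesis by (simp add: d_def)
qed

lemma scaleR_circumcenter:
  assumes "triangle_area a b c \<noteq> 0"
  shows "triangle_area a b c *\<^sub>R circumcenter a b c = weighted_center a b c"
  using assms by (simp add: circumcenter_def equidistant_iff)

section \<open>The base point and its elimination\<close>

lemma collinear_imp_in_affine_hull:
  fixes B u v :: point
  assumes "triangle_area B u v = 0" and "u \<noteq> v"
  shows "B \<in> affine hull {u, v}"
proof -
  define w where "w = v - u"
  have w: "(norm w)\<^sup>2 \<noteq> 0" using assms(2) by (simp add: w_def)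
  have cross: "(B$1 - u$1) * w$2 = (B$2 - u$2) * w$1"
    using assms(1) by (simp add: triangle_area_expand w_def algebra_simps)
  \<comment> \<open>The coefficient of the orthogonal projection of \<open>B - u\<close> onto
    \<open>w\<close>; by \<open>cross\<close>, the projection is \<open>B - u\<close>
    itself.\<close>
  define t where "t = ((B$1 - u$1) * w$1 + (B$2 - u$2) * w$2) / (norm w)\<^sup>2"
  have t: "t * (norm w)\<^sup>2 = (B$1 - u$1) * w$1 + (B$2 - u$2) * w$2"
    using w by (simp add: t_def)
  have "(norm w)\<^sup>2 * (B$1 - u$1) = (norm w)\<^sup>2 * (t * w$1)"
    using cross t norm_point_squared[of w] by algebra
  then have "B$1 - u$1 = t * w$1" using w by simp
  moreover have "(norm w)\<^sup>2 * (B$2 - u$2) = (norm w)\<^sup>2 * (t * w$2)"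
    using cross t norm_point_squared[of w] by algebra
  then have "B$2 - u$2 = t * w$2" using w by simp
  ultimately have "B = (1 - t) *\<^sub>R u + t *\<^sub>R v"
    by (simp add: vec_eq_iff forall_2 w_def algebra_simps)
  then show ?thesis unfolding affine_hull_2 by (intro CollectI exI[of _ "1 - t"] exI[of _ t]) simp
qed

text \<open>For \<open>u = v\<close> the circumcenter is a junk value, but both sides vanish.\<close>

lemma scaleR_circumcenter_off_line:
  assumes "B \<notin> affine hull {u, v}"
  shows "triangle_area B u v *\<^sub>R circumcenter B u v = weighted_center B u v"
proof (cases "u = v")
  case True
  show ?thesis unfolding True
    by (simp add: triangle_area_expand weighted_center_def vec_eq_iff forall_2 algebra_simps)
next
  case False
  then show ?thesis using assms collinear_imp_in_affine_hull scaleR_circumcenter by blast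
qed

text \<open>Every monomial involving B contains coordinates of at most one of u and v, so the B-part
  separates. The witness \<open>h w\<close> is \<open>weighted_center 0 w B\<close>, reflecting the
  signed decomposition of the triangle B u v into triangles with apex 0.\<close>

lemma weighted_center_telescope:
  obtains h where
    "\<And>u v. weighted_center B u v = weighted_center 0 u v + (h v - h u)"
proof
  show "weighted_center B u v = weighted_center 0 u v +
    ((\<lambda>w. (1/4) *\<^sub>R vector [(norm w)\<^sup>2 * B$2 - (norm B)\<^sup>2 * w$2,
        (norm B)\<^sup>2 * w$1 - (norm w)\<^sup>2 * B$1]) v
      - (\<lambda>w. (1/4) *\<^sub>R vector [(norm w)\<^sup>2 * B$2 - (norm B)\<^sup>2 * w$2,
        (norm B)\<^sup>2 * w$1 - (norm w)\<^sup>2 * B$1]) u)" for u v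
    by (simp add: weighted_center_def vec_eq_iff forall_2 field_simps)
qed

text \<open>Finitely many lines, or points where vertices coincide, form a null set and cannot cover
  the plane.\<close>

lemma admissible_base_exists: "\<exists>B. admissible_base P B"
proof -
  let ?U = "\<Union>i<length P. affine hull {vertex P i, vertex P (i + 1)}"
  have "negligible (affine hull {u, v})" for u v :: point
  proof -
    have "interior (affine hull {u, v}) = {}"
      by (rule empty_interior_affine_hull) (auto simp: card_insert_if)
    then show ?thesis
      by (simp add: negligible_convex_interior affine_imp_convex)
  qed
  then have "negligible ?U" by (intro negligible_Union) auto
  then have "?U \<noteq> UNIV" using non_negligible_UNIV by metis
  then show ?thesis unfolding admissible_base_def by blast
qed

text \<open>Removes the base point chosen by \<open>SOME\<close>: its contribution to the weighted
  centers telescopes around P.\<close>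

lemma signed_area_scaleR_CCM:
  assumes "signed_area P \<noteq> 0"
  shows "signed_area P *\<^sub>R CCM P = cyclic_sum (weighted_center 0) P"
proof -
  define B where "B = (SOME B. admissible_base P B)"
  have B: "admissible_base P B"
    unfolding B_def using admissible_base_exists by (rule someI_ex)
  obtain h where h: "\<And>u v. weighted_center B u v = weighted_center 0 u v + (h v - h u)"
    using weighted_center_telescope by blast
  have "signed_area P *\<^sub>R CCM P = (\<Sum>i<length P. triangle_area B (vertex P i) (vertex P (i + 1))
      *\<^sub>R circumcenter B (vertex P i) (vertex P (i + 1)))"
    using assms by (simp add: CCM_def CCM_wrt_def B_def[symmetric] scaleR_sum_right)
  also have "\<dots> = cyclic_sum (weighted_center B) P"
    unfolding cyclic_sum_def
    using B by (intro sum.cong scaleR_circumcenter_off_line) (auto simp: admissible_base_def)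
  also have "\<dots> = cyclic_sum (weighted_center 0) P + cyclic_sum (\<lambda>u v. h v - h u) P"
    by (simp only: cyclic_sum_def h sum.distrib)
  finally show ?thesis by (simp add: cyclic_sum_diff)
qed

text \<open>With apex 0, the triangle areas are the terms of the shoelace formula.\<close>

lemma signed_area_conv_cyclic_sum: "signed_area P = cyclic_sum (triangle_area 0) P"
  by (simp add: signed_area_def cyclic_sum_def triangle_area_expand sum_divide_distrib)

theorem theorem1:
  fixes P X Q R :: "point list" and k :: nat
  assumes "polygon P"
    and "k < length P"
    and "polygonal_line (vertex P 0 # X @ [vertex P k])"
    and "Q = map (vertex P) [0..<k+1] @ rev X"
    and "R = vertex P 0 # X @ map (vertex P) [k..<length P]"
    and "signed_area P \<noteq> 0"
    and "signed_area Q \<noteq> 0"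
    and "signed_area R \<noteq> 0"
  shows "CCM P = (signed_area Q *\<^sub>R CCM Q + signed_area R *\<^sub>R CCM R)
                   /\<^sub>R (signed_area Q + signed_area R)"
proof -
  have "triangle_area 0 v u = - triangle_area 0 u v" for u v
    by (simp add: triangle_area_expand field_simps)
  then have area: "signed_area Q + signed_area R = signed_area P"
    unfolding signed_area_conv_cyclic_sum assms(4,5)
    by (rule cyclic_sum_cut[OF _ assms(2), symmetric])
  have "weighted_center 0 v u = - weighted_center 0 u v" for u v
    by (simp add: weighted_center_def vec_eq_iff forall_2 algebra_simps)
  then have "cyclic_sum (weighted_center 0) P
      = cyclic_sum (weighted_center 0) Q + cyclic_sum (weighted_center 0) R"
    unfolding assms(4,5) by (rule cyclic_sum_cut[OF _ assms(2)])
  then have "signed_area P *\<^sub>R CCM P = signed_area Q *\<^sub>R CCM Q + signed_area R *\<^sub>R CCM R"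
    using assms(6-8) by (simp add: signed_area_scaleR_CCM)
  \<comment> \<open>By \<open>area\<close> the denominator is the area of P, hence nonzero.\<close>
  then show ?thesis
    using assms(6) by (simp add: area flip: \<open>signed_area P *\<^sub>R CCM P = _\<close>)
qed

end
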